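(* Let $\boldsymbol{X}\in\mathbb{R}^{n\times d}$ have rows $\boldsymbol{x}_1,\dots,\boldsymbol{x}_n\in\mathbb{R}^d$ and let $\boldsymbol{Y}\in\mathbb{R}^{n\times m}$ have rows $\boldsymbol{y}_1,\dots,\boldsymbol{y}_n\in\mathbb{R}^m$. The denominator of the test statistic, $$\hat{S}(\boldsymbol{X},\boldsymbol{Y})=\frac{1}{n^{2}}\sum_{k,l=1}^{n}\|\boldsymbol{x}_k-\boldsymbol{x}_l\|^{2}\;\frac{1}{n^{2}}\sum_{k,l=1}^{n}\|\boldsymbol{y}_k-\boldsymbol{y}_l\|^{2},$$ can be expressed as a sum of directional variances as $$\hat{S}(\boldsymbol{X},\boldsymbol{Y})=\sum_{i}\phi_{\boldsymbol{X}}(\boldsymbol{g}_i),$$ where $\boldsymbol{g}_i$ is the $i$-th column of a matrix $\boldsymbol{G}$ such that $\boldsymbol{L}^{S}=\boldsymbol{G}\boldsymbol{G}^{\top}$, for the graph Laplacian matrix $\boldsymbol{L}^{S}$ given by $\boldsymbol{L}^{S}=n\boldsymbol{I}-\boldsymbol{e}\boldsymbol{e}^{\top}$.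
   Context: Here $\boldsymbol{e}\in\mathbb{R}^n$ is the all-ones column vector, $\boldsymbol{I}$ is the $n\times n$ identity matrix, and $\|\cdot\|$ is the Euclidean norm. For a matrix $\boldsymbol{X}$ with $n$ rows and a vector $\boldsymbol{g}\in\mathbb{R}^n$, the directional variance is $\phi_{\boldsymbol{X}}(\boldsymbol{g})=\boldsymbol{g}^{\top}\boldsymbol{X}\boldsymbol{X}^{\top}\boldsymbol{g}$. The test statistic is one for testing independence of the two samples $\boldsymbol{X}$ and $\boldsymbol{Y}$: a ratio whose numerator is a sample distance covariance of $\boldsymbol{X}$ and $\boldsymbol{Y}$ and whose denominator is $\hat{S}(\boldsymbol{X},\boldsymbol{Y})$.
   Formalization: The displayed identity lacks a factor: it is proved as Ŝ(X,Y) = c(Y) Σ_i φ_X(g_i), with c(Y) = (2/n²)(1/n²)Σ‖y_k−y_l‖², equivalently with columns √c(Y) g_i; as printed it fails for n=2, X=Y=(0,1)ᵀ (1/4 versus 1). *)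

theory Defs
  imports "HOL-Analysis.Analysis"
begin

text \<open>
  A sample of size \<open>n\<close> in dimension \<open>d\<close> is a matrix \<open>X :: real^'d^'n\<close> with \<open>n = CARD('n)\<close> rows;
  its \<open>k\<close>-th row is \<open>X $ k\<close>.
\<close>

definition mean_sq_dist :: "real^'d^'n \<Rightarrow> real" where
  "mean_sq_dist X = 1 / (real CARD('n))\<^sup>2 * (\<Sum>k\<in>UNIV. \<Sum>l\<in>UNIV. (norm (X $ k - X $ l))\<^sup>2)"

definition S_hat :: "real^'d^'n \<Rightarrow> real^'m^'n \<Rightarrow> real" where
  "S_hat X Y = mean_sq_dist X * mean_sq_dist Y"

definition directional_variance :: "real^'d^'n \<Rightarrow> real^'n \<Rightarrow> real" where
  "directional_variance X g = g \<bullet> ((X ** transpose X) *v g)"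

definition all_ones :: "real^'n" where
  "all_ones = (\<chi> i. 1)"

definition outer_product :: "real^'n \<Rightarrow> real^'n \<Rightarrow> real^'n^'n" where
  "outer_product u v = (\<chi> i j. u $ i * v $ j)"

definition laplacian_S :: "real^'n^'n" where
  "laplacian_S = real CARD('n) *\<^sub>R mat 1 - outer_product all_ones all_ones"

text \<open>Degree matrix minus adjacency matrix, for a graph on \<open>'n\<close> with weighted adjacency matrix \<open>W\<close>.\<close>

definition graph_laplacian :: "real^'n^'n \<Rightarrow> real^'n^'n" where
  "graph_laplacian W = (\<chi> i j. (if i = j then \<Sum>k\<in>UNIV. W $ i $ k else 0) - W $ i $ j)"

definition complete_graph_adjacency :: "real^'n^'n" where
  "complete_graph_adjacency = (\<chi> i j. if i = j then 0 else 1)"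

text \<open>
  With \<open>laplacian_S = G G\<^sup>T\<close> one has \<open>(\<Sum>k,l. \<parallel>x\<^sub>k - x\<^sub>l\<parallel>\<^sup>2) = 2 * (\<Sum>i. \<phi>\<^sub>X(g\<^sub>i))\<close>, so the
  directional variances along the columns of \<open>G\<close> sum to \<open>S_hat X Y\<close> only up to the following
  factor, which does not depend on \<open>X\<close> or \<open>G\<close>. It cannot be dropped: for \<open>n = 2\<close>, \<open>d = m = 1\<close>
  and both samples equal to \<open>(0, 1)\<close>, \<open>S_hat X Y = 1/4\<close> while the directional variances sum to \<open>1\<close>.
\<close>

definition S_scale :: "real^'m^'n \<Rightarrow> real" where
  "S_scale Y = 2 / (real CARD('n))\<^sup>2 * mean_sq_dist Y"

end

theory Submission
  imports Defs
begin

text \<open>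
  Expanding the quadratic form gives \<open>\<phi>\<^sub>X(g) = (\<Sum>k,l. g\<^sub>k g\<^sub>l (x\<^sub>k \<bullet> x\<^sub>l))\<close>. Summing over the columns
  \<open>g\<close> of \<open>G\<close> replaces the product \<open>g\<^sub>k g\<^sub>l\<close> by the entry \<open>(G G\<^sup>T)\<^sub>k\<^sub>l\<close>, so the sum of the directional
  variances depends on \<open>G\<close> only through \<open>G G\<^sup>T\<close>. For \<open>G G\<^sup>T = n I - e e\<^sup>T\<close> it equals
  \<open>n (\<Sum>k. \<parallel>x\<^sub>k\<parallel>\<^sup>2) - (\<Sum>k,l. x\<^sub>k \<bullet> x\<^sub>l)\<close>, which by expansion of \<open>\<parallel>x\<^sub>k - x\<^sub>l\<parallel>\<^sup>2\<close> is half of the sum of all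
  squared distances (\<open>sum_directional_variance_laplacian\<close>). The factor \<open>S_scale Y\<close> is what turns
  this into the product of the two mean squared distances; since it is nonnegative and \<open>\<phi>\<^sub>X\<close> is
  quadratic, it can be absorbed into \<open>G\<close> through its square root.

  A factorisation exists because \<open>n I - e e\<^sup>T\<close> is \<open>n\<close> times the orthogonal projection onto the
  complement of \<open>e\<close>: it is symmetric and its square is \<open>n\<close> times itself
  (\<open>laplacian_S_square\<close>), so that \<open>(n I - e e\<^sup>T) / sqrt n\<close> is its square root.
\<close>

lemma laplacian_S_nth:
  "(laplacian_S :: real^'n^'n) $ i $ j = (if i = j then real CARD('n) else 0) - 1"
  by (simp add: laplacian_S_def outer_product_def all_ones_def mat_def)

lemma laplacian_S_eq_graph_laplacian:
  "(laplacian_S :: real^'n^'n) = graph_laplacian complete_graph_adjacency"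
proof -
  have degree: "(\<Sum>k\<in>UNIV. if i = k then 0 else (1::real)) = real CARD('n) - 1" for i :: 'n
  proof -
    have "(\<Sum>k\<in>UNIV. if i = k then 0 else (1::real)) = (\<Sum>k\<in>UNIV. 1 - (if i = k then 1 else 0))"
      by (rule sum.cong) auto
    then show ?thesis
      by (simp add: sum_subtractf)
  qed
  show ?thesis
    by (simp add: vec_eq_iff laplacian_S_nth graph_laplacian_def complete_graph_adjacency_def degree)
qed

lemma transpose_laplacian_S: "transpose (laplacian_S :: real^'n^'n) = laplacian_S"
  by (simp add: vec_eq_iff transpose_def laplacian_S_nth)

lemma laplacian_S_square:
  "(laplacian_S :: real^'n^'n) ** laplacian_S = real CARD('n) *\<^sub>R laplacian_S"
proof -
  have "(\<Sum>k\<in>UNIV. laplacian_S $ i $ k * laplacian_S $ k $ j)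
      = real CARD('n) * laplacian_S $ i $ j" for i j :: 'n
  proof -
    have "(\<Sum>k\<in>UNIV. laplacian_S $ i $ k * laplacian_S $ k $ j)
        = (\<Sum>k\<in>UNIV. (if i = k then real CARD('n) * laplacian_S $ k $ j else 0)
            - (if k = j then real CARD('n) else 0) + 1)"
      by (rule sum.cong) (auto simp: laplacian_S_nth algebra_simps)
    then show ?thesis
      by (simp add: sum.distrib sum_subtractf)
  qed
  then show ?thesis
    by (simp add: vec_eq_iff matrix_matrix_mult_def)
qed

lemma laplacian_S_factorization:
  fixes G :: "real^'n^'n"
  defines "G \<equiv> (1 / sqrt (real CARD('n))) *\<^sub>R laplacian_S"
  shows "laplacian_S = G ** transpose G"
proof -
  have "G ** transpose G
      = (1 / sqrt (real CARD('n)) * (1 / sqrt (real CARD('n)))) *\<^sub>R (laplacian_S ** laplacian_S)"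
    unfolding G_def
    by (simp add: transpose_scalar transpose_laplacian_S scalar_matrix_assoc matrix_scalar_ac)
  also have "\<dots> = laplacian_S"
    by (simp add: laplacian_S_square)
  finally show ?thesis ..
qed

lemma directional_variance_eq_double_sum:
  fixes X :: "real^'d^'n"
  shows "directional_variance X g = (\<Sum>k\<in>UNIV. \<Sum>l\<in>UNIV. g $ k * g $ l * (X $ k \<bullet> X $ l))"
  by (simp add: directional_variance_def inner_vec_def matrix_vector_mult_def
      matrix_matrix_mult_def transpose_def sum_distrib_left sum_distrib_right mult_ac)

lemma directional_variance_scaleR:
  "directional_variance X (c *\<^sub>R g) = c\<^sup>2 * directional_variance X g"
  by (simp add: directional_variance_eq_double_sum sum_distrib_left power2_eq_square mult_ac)

text \<open>The trace identity \<open>\<Sum>\<^sub>i \<phi>\<^sub>X(g\<^sub>i) = tr (X\<^sup>T G G\<^sup>T X)\<close>, with the trace written out.\<close>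

lemma sum_directional_variance_columns:
  fixes X :: "real^'d^'n" and G :: "real^'p^'n"
  shows "(\<Sum>i\<in>UNIV. directional_variance X (column i G))
    = (\<Sum>k\<in>UNIV. \<Sum>l\<in>UNIV. (G ** transpose G) $ k $ l * (X $ k \<bullet> X $ l))"
proof -
  have "(\<Sum>i\<in>UNIV. directional_variance X (column i G))
      = (\<Sum>i\<in>UNIV. \<Sum>k\<in>UNIV. \<Sum>l\<in>UNIV. G $ k $ i * G $ l $ i * (X $ k \<bullet> X $ l))"
    by (simp add: directional_variance_eq_double_sum column_def)
  also have "\<dots> = (\<Sum>k\<in>UNIV. \<Sum>i\<in>UNIV. \<Sum>l\<in>UNIV. G $ k $ i * G $ l $ i * (X $ k \<bullet> X $ l))"
    by (rule sum.swap)
  also have "\<dots> = (\<Sum>k\<in>UNIV. \<Sum>l\<in>UNIV. \<Sum>i\<in>UNIV. G $ k $ i * G $ l $ i * (X $ k \<bullet> X $ l))"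
    by (intro sum.cong refl sum.swap)
  finally show ?thesis
    by (simp add: matrix_matrix_mult_def transpose_def sum_distrib_right)
qed

lemma sum_sq_dist_expand:
  fixes X :: "real^'d^'n"
  shows "(\<Sum>k\<in>UNIV. \<Sum>l\<in>UNIV. (norm (X $ k - X $ l))\<^sup>2)
    = 2 * (real CARD('n) * (\<Sum>k\<in>UNIV. X $ k \<bullet> X $ k) - (\<Sum>k\<in>UNIV. \<Sum>l\<in>UNIV. X $ k \<bullet> X $ l))"
proof -
  have "(norm (X $ k - X $ l))\<^sup>2 = X $ k \<bullet> X $ k + X $ l \<bullet> X $ l - 2 * (X $ k \<bullet> X $ l)" for k l
    by (simp add: power2_norm_eq_inner inner_diff_left inner_diff_right inner_commute)
  then show ?thesis
    by (simp add: sum.distrib sum_subtractf flip: sum_distrib_left)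
qed

lemma sum_directional_variance_laplacian:
  fixes X :: "real^'d^'n" and G :: "real^'p^'n"
  assumes "laplacian_S = G ** transpose G"
  shows "(\<Sum>k\<in>UNIV. \<Sum>l\<in>UNIV. (norm (X $ k - X $ l))\<^sup>2)
    = 2 * (\<Sum>i\<in>UNIV. directional_variance X (column i G))"
proof -
  have "(\<Sum>i\<in>UNIV. directional_variance X (column i G))
      = (\<Sum>k\<in>UNIV. \<Sum>l\<in>UNIV. (laplacian_S :: real^'n^'n) $ k $ l * (X $ k \<bullet> X $ l))"
    by (simp add: sum_directional_variance_columns assms)
  also have "\<dots> = (\<Sum>k\<in>UNIV. \<Sum>l\<in>UNIV.
      (if k = l then real CARD('n) * (X $ k \<bullet> X $ l) else 0) - X $ k \<bullet> X $ l)"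
    by (intro sum.cong refl) (simp add: laplacian_S_nth algebra_simps)
  also have "\<dots> = real CARD('n) * (\<Sum>k\<in>UNIV. X $ k \<bullet> X $ k) - (\<Sum>k\<in>UNIV. \<Sum>l\<in>UNIV. X $ k \<bullet> X $ l)"
    by (simp add: sum_subtractf flip: sum_distrib_left)
  finally show ?thesis
    by (simp add: sum_sq_dist_expand)
qed

lemma S_hat_eq_scaled_sum:
  fixes X :: "real^'d^'n" and Y :: "real^'m^'n" and G :: "real^'p^'n"
  assumes "laplacian_S = G ** transpose G"
  shows "S_hat X Y = S_scale Y * (\<Sum>i\<in>UNIV. directional_variance X (column i G))"
  by (simp add: S_hat_def S_scale_def mean_sq_dist_def[of X]
      sum_directional_variance_laplacian[OF assms])

lemma S_scale_nonneg: "0 \<le> S_scale Y"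
  by (simp add: S_scale_def mean_sq_dist_def sum_nonneg)

lemma sum_directional_variance_sqrt_scaled:
  fixes X :: "real^'d^'n" and G :: "real^'p^'n"
  assumes "0 \<le> c"
  shows "(\<Sum>i\<in>UNIV. directional_variance X (column i (sqrt c *\<^sub>R G)))
    = c * (\<Sum>i\<in>UNIV. directional_variance X (column i G))"
proof -
  have "column i (sqrt c *\<^sub>R G) = sqrt c *\<^sub>R column i G" for i
    by (simp add: vec_eq_iff column_def)
  then show ?thesis
    using assms by (simp add: directional_variance_scaleR sum_distrib_left)
qed

theorem mainTheorem1:
  fixes X :: "real^'d^'n" and Y :: "real^'m^'n"
  shows "(laplacian_S :: real^'n^'n) = graph_laplacian complete_graph_adjacency
    \<and> (\<exists>G :: real^'n^'n. laplacian_S = G ** transpose G)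
    \<and> (\<forall>G :: real^'p^'n. laplacian_S = G ** transpose G \<longrightarrow>
         S_hat X Y = S_scale Y * (\<Sum>i\<in>UNIV. directional_variance X (column i G)) \<and>
         S_hat X Y = (\<Sum>i\<in>UNIV. directional_variance X (column i (sqrt (S_scale Y) *\<^sub>R G))))"
  using laplacian_S_eq_graph_laplacian laplacian_S_factorization S_hat_eq_scaled_sum
  by (auto simp: sum_directional_variance_sqrt_scaled[OF S_scale_nonneg])

end
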